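(* Let $A=\sigma(R)\langle x_1,\dots,x_n\rangle$ be a skew PBW extension of a ring $R$, with associated family of endomorphisms $\Sigma=\{\sigma_1,\dots,\sigma_n\}$. If $R$ is $\Sigma$-rigid, then $R$ is skew $\Pi$-Armendariz (with respect to $A$).
   Context: Rings are associative with unity, not necessarily commutative; $\mathrm{nil}(B)$ is the set of nilpotent elements of a ring $B$. Skew PBW extension ($\sigma$-PBW extension): $A=\sigma(R)\langle x_1,\dots,x_n\rangle$ is a skew PBW extension of $R$ if (i) $R\subseteq A$ is a subring; (ii) there are $x_1,\dots,x_n\in A$ such that $A$ is a free left $R$-module with basis $\mathrm{Mon}(A)=\{x^\alpha=x_1^{\alpha_1}\cdots x_n^{\alpha_n}\mid \alpha\in\mathbb N^n\}$, with $x_1^0\cdots x_n^0=1$; (iii) for each $1\le i\le n$ and $r\in R\setminus\{0\}$ there is $c_{i,r}\in R\setminus\{0\}$ with $x_ir-c_{i,r}x_i\in R$; (iv) for all $1\le i,j\le n$ there is $c_{i,j}\in R\setminus\{0\}$ with $x_jx_i-c_{i,j}x_ix_j\in R+Rx_1+\cdots+Rx_n$. It is known that for each $i$ there are an injective ring endomorphism $\sigma_i:R\to R$ and a $\sigma_i$-derivation $\delta_i:R\to R$ (additive, $\delta_i(rs)=\sigma_i(r)\delta_i(s)+\delta_i(r)s$) with $x_ir=\sigma_i(r)x_i+\delta_i(r)$ for all $r\in R$; $\Sigma=\{\sigma_1,\dots,\sigma_n\}$ is this family of endomorphisms. For $\alpha\in\mathbb N^n$, $\sigma^\alpha=\sigma_1^{\alpha_1}\cdots\sigma_n^{\alpha_n}$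 (composition). $\Sigma$-rigid: $R$ is $\Sigma$-rigid if for every $r\in R$ and every $\alpha\in\mathbb N^n$, $r\sigma^\alpha(r)=0$ implies $r=0$. Elements of $A$ are written $f=\sum_{i=0}^m a_iX_i$ with $a_i\in R$, $X_0=1$, and $X_0,X_1,\dots,X_m$ distinct elements of $\mathrm{Mon}(A)$. Skew $\Pi$-Armendariz: $R$ is skew $\Pi$-Armendariz (with respect to $A$) if for all $f=\sum_{i=0}^m a_iX_i$ and $g=\sum_{j=0}^t b_jY_j$ in $A$, $fg\in\mathrm{nil}(A)$ implies $a_ib_j\in\mathrm{nil}(R)$ for all $0\le i\le m$, $0\le j\le t$. *)

theory Defs imports Main begin

text \<open>
  Throughout, the ring \<open>A\<close> is (the universe of) a type of class \<open>ring_1\<close>, so it need not be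
  commutative, and \<open>R\<close> is a subset of that type. The generators \<open>x\<close> and the maps \<open>\<sigma>\<close>, \<open>\<delta>\<close> are
  indexed by \<open>{1..n}\<close>; their values at other indices are irrelevant.
\<close>

definition is_subring :: "'a::ring_1 set \<Rightarrow> bool" where
  "is_subring R \<longleftrightarrow> 1 \<in> R \<and> (\<forall>a\<in>R. \<forall>b\<in>R. a - b \<in> R \<and> a * b \<in> R)"

definition nil :: "'a::ring_1 set \<Rightarrow> 'a set" where
  "nil B = {b \<in> B. \<exists>k>0. b ^ k = 0}"

text \<open>The exponents \<open>\<alpha> \<in> \<nat>\<^sup>n\<close>, encoded as functions vanishing outside \<open>{1..n}\<close>.\<close>

definition exponents :: "nat \<Rightarrow> (nat \<Rightarrow> nat) set" where
  "exponents n = {\<alpha>. \<forall>i. i \<notin> {1..n} \<longrightarrow> \<alpha> i = 0}"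

text \<open>The factors do not commute: \<open>monomial n x \<alpha>\<close> is \<open>x\<^sub>1\<^bsup>\<alpha> 1\<^esup> \<cdots> x\<^sub>n\<^bsup>\<alpha> n\<^esup>\<close> in this order.\<close>

definition monomial :: "nat \<Rightarrow> (nat \<Rightarrow> 'a::ring_1) \<Rightarrow> (nat \<Rightarrow> nat) \<Rightarrow> 'a" where
  "monomial n x \<alpha> = prod_list (map (\<lambda>i. x i ^ \<alpha> i) [1..<Suc n])"

definition Mon :: "nat \<Rightarrow> (nat \<Rightarrow> 'a::ring_1) \<Rightarrow> 'a set" where
  "Mon n x = monomial n x ` exponents n"

text \<open>
  The family \<open>(v i)\<^bsub>i \<in> I\<^esub>\<close> is a basis of the ambient ring as a left \<open>R\<close>-module. Being a basis
  as a family, its members are pairwise distinct if \<open>R\<close> is a subring. (The library's module theories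
  require commutative scalars.)
\<close>

definition left_basis :: "'a::ring_1 set \<Rightarrow> 'i set \<Rightarrow> ('i \<Rightarrow> 'a) \<Rightarrow> bool" where
  "left_basis R I v \<longleftrightarrow>
     (\<forall>f. \<exists>S c. finite S \<and> S \<subseteq> I \<and> (\<forall>i\<in>S. c i \<in> R) \<and> f = (\<Sum>i\<in>S. c i * v i)) \<and>
     (\<forall>S c. finite S \<and> S \<subseteq> I \<and> (\<forall>i\<in>S. c i \<in> R) \<and> (\<Sum>i\<in>S. c i * v i) = 0
        \<longrightarrow> (\<forall>i\<in>S. c i = 0))"

text \<open>The set \<open>R + R x\<^sub>1 + \<cdots> + R x\<^sub>n\<close>.\<close>

definition affine_forms :: "'a::ring_1 set \<Rightarrow> nat \<Rightarrow> (nat \<Rightarrow> 'a) \<Rightarrow> 'a set" where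
  "affine_forms R n x = {r 0 + (\<Sum>k=1..n. r k * x k) | r. \<forall>k\<le>n. r k \<in> R}"

definition skew_PBW_extension :: "'a::ring_1 set \<Rightarrow> nat \<Rightarrow> (nat \<Rightarrow> 'a) \<Rightarrow> bool" where
  "skew_PBW_extension R n x \<longleftrightarrow>
     is_subring R \<and>
     left_basis R (exponents n) (monomial n x) \<and>
     (\<forall>i\<in>{1..n}. \<forall>r\<in>R - {0}. \<exists>c\<in>R - {0}. x i * r - c * x i \<in> R) \<and>
     (\<forall>i\<in>{1..n}. \<forall>j\<in>{1..n}. \<exists>c\<in>R - {0}. x j * x i - c * x i * x j \<in> affine_forms R n x)"

definition is_endomorphism :: "'a::ring_1 set \<Rightarrow> ('a \<Rightarrow> 'a) \<Rightarrow> bool" where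
  "is_endomorphism R s \<longleftrightarrow>
     (\<forall>r\<in>R. s r \<in> R) \<and> s 1 = 1 \<and>
     (\<forall>a\<in>R. \<forall>b\<in>R. s (a + b) = s a + s b \<and> s (a * b) = s a * s b)"

definition is_derivation :: "'a::ring_1 set \<Rightarrow> ('a \<Rightarrow> 'a) \<Rightarrow> ('a \<Rightarrow> 'a) \<Rightarrow> bool" where
  "is_derivation R s d \<longleftrightarrow>
     (\<forall>r\<in>R. d r \<in> R) \<and>
     (\<forall>a\<in>R. \<forall>b\<in>R. d (a + b) = d a + d b \<and> d (a * b) = s a * d b + d a * b)"

text \<open>
  \<open>\<sigma>\<close> and \<open>\<delta>\<close> are the families of injective endomorphisms and of \<open>\<sigma> i\<close>-derivations of \<open>R\<close>
  associated with the extension. They exist and are unique on \<open>R\<close>; see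
  \<open>associated_maps_exist\<close> and \<open>associated_maps_unique\<close> below.
\<close>

definition associated_maps ::
    "'a::ring_1 set \<Rightarrow> nat \<Rightarrow> (nat \<Rightarrow> 'a) \<Rightarrow> (nat \<Rightarrow> 'a \<Rightarrow> 'a) \<Rightarrow> (nat \<Rightarrow> 'a \<Rightarrow> 'a) \<Rightarrow> bool" where
  "associated_maps R n x \<sigma> \<delta> \<longleftrightarrow>
     (\<forall>i\<in>{1..n}. is_endomorphism R (\<sigma> i) \<and> inj_on (\<sigma> i) R \<and> is_derivation R (\<sigma> i) (\<delta> i) \<and>
        (\<forall>r\<in>R. x i * r = \<sigma> i r * x i + \<delta> i r))"

text \<open>\<open>\<sigma>\<^sup>\<alpha>\<close> is \<open>\<sigma>\<^sub>1\<^bsup>\<alpha> 1\<^esup> \<circ> \<cdots> \<circ> \<sigma>\<^sub>n\<^bsup>\<alpha> n\<^esup>\<close>.\<close>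

definition endo_power :: "nat \<Rightarrow> (nat \<Rightarrow> 'a \<Rightarrow> 'a) \<Rightarrow> (nat \<Rightarrow> nat) \<Rightarrow> 'a \<Rightarrow> 'a" where
  "endo_power n \<sigma> \<alpha> = foldr (\<circ>) (map (\<lambda>i. \<sigma> i ^^ \<alpha> i) [1..<Suc n]) id"

definition Sigma_rigid :: "'a::ring_1 set \<Rightarrow> nat \<Rightarrow> (nat \<Rightarrow> 'a \<Rightarrow> 'a) \<Rightarrow> bool" where
  "Sigma_rigid R n \<sigma> \<longleftrightarrow>
     (\<forall>r\<in>R. \<forall>\<alpha>\<in>exponents n. r * endo_power n \<sigma> \<alpha> r = 0 \<longrightarrow> r = 0)"

text \<open>
  A presentation \<open>a\<^sub>0 X\<^sub>0 + \<cdots> + a\<^sub>m X\<^sub>m\<close> with coefficients in \<open>R\<close>, \<open>X\<^sub>0 = 1\<close> and pairwise distinct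
  monomials \<open>X\<^sub>0, \<dots>, X\<^sub>m\<close>; zero coefficients are allowed.
\<close>

definition presentation ::
    "'a::ring_1 set \<Rightarrow> nat \<Rightarrow> (nat \<Rightarrow> 'a) \<Rightarrow> nat \<Rightarrow> (nat \<Rightarrow> 'a) \<Rightarrow> (nat \<Rightarrow> 'a) \<Rightarrow> bool" where
  "presentation R n x m a X \<longleftrightarrow>
     (\<forall>i\<le>m. a i \<in> R \<and> X i \<in> Mon n x) \<and> X 0 = 1 \<and> inj_on X {..m}"

definition skew_Pi_Armendariz :: "'a::ring_1 set \<Rightarrow> nat \<Rightarrow> (nat \<Rightarrow> 'a) \<Rightarrow> bool" where
  "skew_Pi_Armendariz R n x \<longleftrightarrow>
     (\<forall>m t a b X Y. presentation R n x m a X \<and> presentation R n x t b Y \<and>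
        (\<Sum>i\<le>m. a i * X i) * (\<Sum>j\<le>t. b j * Y j) \<in> nil UNIV
        \<longrightarrow> (\<forall>i\<le>m. \<forall>j\<le>t. a i * b j \<in> nil R))"

lemma subring_closed:
  assumes "is_subring R"
  shows "0 \<in> R" "1 \<in> R" "a \<in> R \<Longrightarrow> b \<in> R \<Longrightarrow> a - b \<in> R"
    "a \<in> R \<Longrightarrow> b \<in> R \<Longrightarrow> a * b \<in> R" "a \<in> R \<Longrightarrow> b \<in> R \<Longrightarrow> a + b \<in> R"
proof -
  have d: "a - b \<in> R" if "a \<in> R" "b \<in> R" for a b
    using assms that unfolding is_subring_def by blast
  show one: "1 \<in> R" using assms unfolding is_subring_def by blast
  show zero: "0 \<in> R" using d[OF one one] by simp
  show "a \<in> R \<Longrightarrow> b \<in> R \<Longrightarrow> a - b \<in> R" by (rule d)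
  show "a \<in> R \<Longrightarrow> b \<in> R \<Longrightarrow> a * b \<in> R" using assms unfolding is_subring_def by blast
  show "a + b \<in> R" if "a \<in> R" "b \<in> R" using d[OF that(1) d[OF zero that(2)]] by simp
qed

lemma monomial_unit:
  assumes "i \<in> {1..n}"
  shows "monomial n x (\<lambda>j. if j = i then 1 else 0) = x i"
proof -
  have "prod_list (map (\<lambda>j. x j ^ (if j = i then 1 else 0)) xs) = (if i \<in> set xs then x i else 1)"
    if "distinct xs" for xs
    using that by (induction xs) auto
  from this[of "[1..<Suc n]"] show ?thesis
    using assms unfolding monomial_def by auto
qed

lemma monomial_zero: "monomial n x (\<lambda>j. 0) = 1"
  unfolding monomial_def by (induction n) auto

lemma linear_form_eq:
  assumes A: "skew_PBW_extension R n x" and i: "i \<in> {1..n}"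
    and R: "a \<in> R" "b \<in> R" "a' \<in> R" "b' \<in> R"
    and eq: "a * x i + b = a' * x i + b'"
  shows "a = a'" "b = b'"
proof -
  let ?e = "\<lambda>j. if j = i then 1 else 0 :: nat"
  let ?c = "\<lambda>\<alpha>. if \<alpha> = ?e then a - a' else b - b'"
  have ne: "?e \<noteq> (\<lambda>j. 0)" by (auto dest: fun_cong[of _ _ i])
  have sub: "is_subring R" and basis: "left_basis R (exponents n) (monomial n x)"
    using A unfolding skew_PBW_extension_def by auto
  have "(\<Sum>\<alpha>\<in>{?e, \<lambda>j. 0}. ?c \<alpha> * monomial n x \<alpha>) = (a - a') * x i + (b - b')"
    using ne monomial_unit[OF i, of x] monomial_zero[of n x] by (subst sum.insert) auto
  also have "\<dots> = 0" using eq by (simp add: algebra_simps)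
  finally have z: "(\<Sum>\<alpha>\<in>{?e, \<lambda>j. 0}. ?c \<alpha> * monomial n x \<alpha>) = 0" .
  have 1: "{?e, \<lambda>j. 0} \<subseteq> exponents n" using i unfolding exponents_def by auto
  have 2: "\<forall>\<alpha>\<in>{?e, \<lambda>j. 0}. ?c \<alpha> \<in> R" using subring_closed(3)[OF sub] R by auto
  have indep: "\<forall>i\<in>S. c i = 0"
    if "finite S" "S \<subseteq> exponents n" "\<forall>i\<in>S. c i \<in> R" "(\<Sum>i\<in>S. c i * monomial n x i) = 0" for S c
    using basis that unfolding left_basis_def by blast
  have "\<forall>\<alpha>\<in>{?e, \<lambda>j. 0}. ?c \<alpha> = 0"
    by (rule indep[OF _ 1 2 z]) simp
  then have "?c ?e = 0" "?c (\<lambda>j. 0) = 0" by (rule bspec, simp)+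
  then show "a = a'" "b = b'" using ne by auto
qed

lemma associated_maps_unique:
  assumes "skew_PBW_extension R n x" "associated_maps R n x \<sigma> \<delta>" "associated_maps R n x \<sigma>' \<delta>'"
    and "i \<in> {1..n}" "r \<in> R"
  shows "\<sigma> i r = \<sigma>' i r" "\<delta> i r = \<delta>' i r"
proof -
  have "\<sigma> i r \<in> R" "\<delta> i r \<in> R" "\<sigma>' i r \<in> R" "\<delta>' i r \<in> R"
    using assms unfolding associated_maps_def is_endomorphism_def is_derivation_def by blast+
  moreover have "x i * r = \<sigma> i r * x i + \<delta> i r" "x i * r = \<sigma>' i r * x i + \<delta>' i r"
    using assms unfolding associated_maps_def by blast+
  then have "\<sigma> i r * x i + \<delta> i r = \<sigma>' i r * x i + \<delta>' i r" by simp
  ultimately have mem: "\<sigma> i r \<in> R" "\<delta> i r \<in> R" "\<sigma>' i r \<in> R" "\<delta>' i r \<in> R"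
    "\<sigma> i r * x i + \<delta> i r = \<sigma>' i r * x i + \<delta>' i r" by this+
  from linear_form_eq[OF assms(1,4) mem] show "\<sigma> i r = \<sigma>' i r" "\<delta> i r = \<delta>' i r" .
qed

lemma associated_maps_exist:
  assumes A: "skew_PBW_extension R n x"
  shows "\<exists>\<sigma> \<delta>. associated_maps R n x \<sigma> \<delta>"
proof -
  have sub: "is_subring R"
    and c: "\<forall>i\<in>{1..n}. \<forall>r\<in>R - {0}. \<exists>c\<in>R - {0}. x i * r - c * x i \<in> R"
    using A unfolding skew_PBW_extension_def by auto
  note cl = subring_closed[OF sub]
  have "\<exists>s d. s \<in> R \<and> d \<in> R \<and> x i * r = s * x i + d \<and> (r \<noteq> 0 \<longrightarrow> s \<noteq> 0)"
    if "i \<in> {1..n}" "r \<in> R" for i r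
  proof (cases "r = 0")
    case True
    then show ?thesis using cl(1) by (intro exI[of _ 0]) auto
  next
    case False
    then obtain s where "s \<in> R - {0}" "x i * r - s * x i \<in> R" using c \<open>i \<in> _\<close> \<open>r \<in> R\<close> by blast
    then show ?thesis by (intro exI[of _ s] exI[of _ "x i * r - s * x i"]) auto
  qed
  then obtain \<sigma> \<delta> where
    R: "\<And>i r. i \<in> {1..n} \<Longrightarrow> r \<in> R \<Longrightarrow> \<sigma> i r \<in> R \<and> \<delta> i r \<in> R" and
    eq: "\<And>i r. i \<in> {1..n} \<Longrightarrow> r \<in> R \<Longrightarrow> x i * r = \<sigma> i r * x i + \<delta> i r" and
    nz: "\<And>i r. i \<in> {1..n} \<Longrightarrow> r \<in> R \<Longrightarrow> r \<noteq> 0 \<Longrightarrow> \<sigma> i r \<noteq> 0"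
    by metis
  have "associated_maps R n x \<sigma> \<delta>"
    unfolding associated_maps_def
  proof (intro ballI conjI)
    fix i assume i: "i \<in> {1..n}"
    note uniq = linear_form_eq[OF A i]
    have add: "\<sigma> i (a + b) = \<sigma> i a + \<sigma> i b" "\<delta> i (a + b) = \<delta> i a + \<delta> i b"
      if ab: "a \<in> R" "b \<in> R" for a b
    proof -
      have mem: "\<sigma> i (a + b) \<in> R" "\<delta> i (a + b) \<in> R" "\<sigma> i a + \<sigma> i b \<in> R" "\<delta> i a + \<delta> i b \<in> R"
        using R[OF i] ab cl(5) by simp_all
      have "\<sigma> i (a + b) * x i + \<delta> i (a + b) = (\<sigma> i a + \<sigma> i b) * x i + (\<delta> i a + \<delta> i b)"
        using eq[OF i ab(1)] eq[OF i ab(2)] eq[OF i cl(5)[OF ab]]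
        by (simp add: distrib_left distrib_right add_ac)
      from uniq[OF mem this]
      show "\<sigma> i (a + b) = \<sigma> i a + \<sigma> i b" "\<delta> i (a + b) = \<delta> i a + \<delta> i b" .
    qed
    have mult: "\<sigma> i (a * b) = \<sigma> i a * \<sigma> i b" "\<delta> i (a * b) = \<sigma> i a * \<delta> i b + \<delta> i a * b"
      if ab: "a \<in> R" "b \<in> R" for a b
    proof -
      have mem: "\<sigma> i (a * b) \<in> R" "\<delta> i (a * b) \<in> R" "\<sigma> i a * \<sigma> i b \<in> R"
        "\<sigma> i a * \<delta> i b + \<delta> i a * b \<in> R"
        using R[OF i] ab cl(4,5) by simp_all
      have "\<sigma> i (a * b) * x i + \<delta> i (a * b) = (x i * a) * b"
        using eq[OF i cl(4)[OF ab]] by (simp add: mult.assoc)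
      also have "\<dots> = \<sigma> i a * (x i * b) + \<delta> i a * b"
        using eq[OF i ab(1)] by (simp add: distrib_right mult.assoc)
      also have "\<dots> = (\<sigma> i a * \<sigma> i b) * x i + (\<sigma> i a * \<delta> i b + \<delta> i a * b)"
        using eq[OF i ab(2)] by (simp add: distrib_left mult.assoc add_ac)
      finally have "\<sigma> i (a * b) * x i + \<delta> i (a * b) =
        (\<sigma> i a * \<sigma> i b) * x i + (\<sigma> i a * \<delta> i b + \<delta> i a * b)" .
      from uniq[OF mem this]
      show "\<sigma> i (a * b) = \<sigma> i a * \<sigma> i b" "\<delta> i (a * b) = \<sigma> i a * \<delta> i b + \<delta> i a * b" .
    qed
    have one: "\<sigma> i 1 = 1"
      using uniq(1)[of "\<sigma> i 1" "\<delta> i 1" 1 0] eq[OF i cl(2)] R[OF i cl(2)] cl(1,2) by simp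
    show "is_endomorphism R (\<sigma> i)"
      unfolding is_endomorphism_def using R[OF i] add mult one by blast
    show "is_derivation R (\<sigma> i) (\<delta> i)"
      unfolding is_derivation_def using R[OF i] add mult by blast
    show "inj_on (\<sigma> i) R"
    proof (rule inj_onI)
      fix a b assume ab: "a \<in> R" "b \<in> R" "\<sigma> i a = \<sigma> i b"
      have "\<sigma> i a = \<sigma> i (a - b) + \<sigma> i b" using add(1)[of "a - b" b] ab cl(3) by simp
      then show "a = b" using nz[OF i cl(3)[OF ab(1,2)]] ab(3) by auto
    qed
    show "x i * r = \<sigma> i r * x i + \<delta> i r" if "r \<in> R" for r using eq[OF i that] .
  qed
  then show ?thesis by blast
qed

end

theory Submission imports Defs begin

text \<open>
  Order the exponents by total degree first and lexicographically second. Since \<open>R\<close> is reduced,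
  the constants \<open>c\<^sub>i\<^sub>j\<close> are invertible, and the product of elements with leading terms
  \<open>a x\<^sup>\<alpha>\<close> and \<open>b x\<^sup>\<beta>\<close> is \<open>a \<sigma>\<^sup>\<alpha>(b) u x\<^bsup>\<alpha>+\<beta>\<^esup>\<close> plus smaller terms, with a unit \<open>u\<close>. Applied to
  \<open>f f\<close>, rigidity shows that \<open>A\<close> is reduced, so a nilpotent product \<open>f g\<close> vanishes. If \<open>f g = 0\<close>
  with leading coefficients \<open>a\<close> and \<open>b\<close>, rigidity gives \<open>a b = 0\<close>. As \<open>A\<close> is reduced, \<open>b A a = 0\<close>,
  so the leading term of \<open>g\<close> dies in \<open>f g a = 0\<close>; induction on \<open>g\<close> yields
  \<open>a g a = 0\<close>, hence \<open>a g = 0\<close>. Then \<open>a A g = 0\<close> allows us to remove the leading term of \<open>f\<close>.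
\<close>

section \<open>Reduced rings\<close>

text \<open>For positive \<open>k\<close>, \<open>z ^ Suc k = 0\<close> forces
  \<open>(z ^ k)\<^sup>2 = 0\<close>, because 2k is at least k + 1; so the exponent descends to
  1.\<close>

lemma reduced_power_eq_0:
  fixes z :: "'a::ring_1"
  assumes red: "\<And>z::'a. z * z = 0 \<Longrightarrow> z = 0"
  shows "z ^ k = 0 \<Longrightarrow> z = 0"
proof (induction k)
  case 0
  \<comment> \<open>The premise reads \<open>z ^ 0 = 0\<close>, that is 1 = 0, so the ring is
    trivial.\<close>
  have "z = z * z ^ 0" by simp
  also have "\<dots> = 0" unfolding 0 by (rule mult_zero_right)
  finally show ?case .
next
  case (Suc k)
  show ?case
  proof (cases k)
    case 0
    then show ?thesis using Suc.prems by simp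
  next
    case (Suc m)
    have "z ^ k * z ^ k = z ^ Suc k * z ^ m"
      by (simp only: power_add[symmetric] Suc add_Suc add_Suc_right)
    also have "\<dots> = 0" unfolding \<open>z ^ Suc k = 0\<close> by (rule mult_zero_left)
    finally have "z ^ k = 0" by (rule red)
    then show ?thesis by (rule Suc.IH)
  qed
qed

text \<open>Reduced rings are reversible, and annihilation survives inserting a factor: the square
  of each product in question contains \<open>a * b\<close> or \<open>b * a\<close>.\<close>

lemma reduced_insert:
  fixes a b r :: "'a::ring_1"
  assumes red: "\<And>z::'a. z * z = 0 \<Longrightarrow> z = 0" and ab: "a * b = 0"
  shows "a * r * b = 0" "b * r * a = 0"
proof -
  have "(b * a) * (b * a) = b * (a * b) * a" by (simp only: mult.assoc)
  also have "\<dots> = 0" using ab by simp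
  finally have ba: "b * a = 0" by (rule red)
  have "(a * r * b) * (a * r * b) = a * r * (b * a) * r * b" by (simp only: mult.assoc)
  also have "\<dots> = 0" using ba by simp
  finally show "a * r * b = 0" by (rule red)
  have "(b * r * a) * (b * r * a) = b * r * (a * b) * r * a" by (simp only: mult.assoc)
  also have "\<dots> = 0" using ab by simp
  finally show "b * r * a = 0" by (rule red)
qed

section \<open>The degree-lexicographic order on exponents\<close>

definition tdeg :: "nat \<Rightarrow> (nat \<Rightarrow> nat) \<Rightarrow> nat" where
  "tdeg n \<alpha> = (\<Sum>i=1..n. \<alpha> i)"

text \<open>Comparing degrees first makes whatever a derivation or a reordering leaves behind
  smaller than the leading term, and gives each exponent only finitely many predecessors.\<close>

definition deglex :: "nat \<Rightarrow> (nat \<Rightarrow> nat) \<Rightarrow> (nat \<Rightarrow> nat) \<Rightarrow> bool" where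
  "deglex n \<alpha> \<beta> \<longleftrightarrow> tdeg n \<alpha> < tdeg n \<beta> \<or>
     tdeg n \<alpha> = tdeg n \<beta> \<and> (\<exists>k. \<alpha> k < \<beta> k \<and> (\<forall>i<k. \<alpha> i = \<beta> i))"

text \<open>The position in the order as a natural number, so that induction on leading exponents
  becomes induction on \<open>nat\<close>.\<close>

definition rank :: "nat \<Rightarrow> (nat \<Rightarrow> nat) \<Rightarrow> nat" where
  "rank n \<alpha> = card {\<gamma> \<in> exponents n. deglex n \<gamma> \<alpha>}"

lemma tdeg_add: "tdeg n (\<lambda>i. \<alpha> i + \<beta> i) = tdeg n \<alpha> + tdeg n \<beta>"
  unfolding tdeg_def by (rule sum.distrib)

lemma tdeg_upd:
  assumes "j \<in> {1..n}"
  shows "tdeg n (\<alpha>(j := Suc (\<alpha> j))) = Suc (tdeg n \<alpha>)"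
  unfolding tdeg_def using assms by (simp add: sum.remove[of _ j])

lemma exponents_upd:
  "\<alpha> \<in> exponents n \<Longrightarrow> j \<in> {1..n} \<Longrightarrow> \<alpha>(j := Suc (\<alpha> j)) \<in> exponents n"
  unfolding exponents_def by auto

lemma exponents_add:
  "\<alpha> \<in> exponents n \<Longrightarrow> \<beta> \<in> exponents n \<Longrightarrow> (\<lambda>i. \<alpha> i + \<beta> i) \<in> exponents n"
  unfolding exponents_def by auto

text \<open>The index \<open>j\<close> is the least one that occurs in \<open>\<alpha>\<close>, so
  this case splits the leftmost generator off the monomial.\<close>

lemma exponents_cases:
  assumes "\<alpha> \<in> exponents n"
  obtains "\<alpha> = (\<lambda>i. 0)"
  | j \<alpha>' where "j \<in> {1..n}" "\<alpha>' \<in> exponents n" "\<forall>i<j. \<alpha>' i = 0" "\<alpha> = \<alpha>'(j := Suc (\<alpha>' j))"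
proof (cases "\<exists>j. \<alpha> j \<noteq> 0")
  case False
  then show ?thesis using that(1) by auto
next
  case True
  define j where "j = (LEAST j. \<alpha> j \<noteq> 0)"
  have j: "\<alpha> j \<noteq> 0" using LeastI_ex[OF True] unfolding j_def .
  have lt: "\<forall>i<j. \<alpha> i = 0" using not_less_Least unfolding j_def by blast
  have "j \<in> {1..n}" using assms j unfolding exponents_def by auto
  then show ?thesis
    using assms j lt by (intro that(2)[of j "\<alpha>(j := \<alpha> j - 1)"]) (auto simp: exponents_def)
qed

text \<open>A monomial is built from the right: each new generator is put in front and its index
  exceeds none of those already present, so no reordering occurs.\<close>

lemma exponents_induct [consumes 1, case_names zero upd]:
  assumes "\<alpha> \<in> exponents n" and "P (\<lambda>i. 0)"
    and step: "\<And>\<alpha> j. \<alpha> \<in> exponents n \<Longrightarrow> j \<in> {1..n} \<Longrightarrow> \<forall>i<j. \<alpha> i = 0 \<Longrightarrow> P \<alpha> \<Longrightarrow>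
      P (\<alpha>(j := Suc (\<alpha> j)))"
  shows "P \<alpha>"
  using assms(1)
proof (induction "tdeg n \<alpha>" arbitrary: \<alpha> rule: less_induct)
  case less
  from less.prems show ?case
  proof (cases rule: exponents_cases)
    case 1
    then show ?thesis using assms(2) by simp
  next
    case (2 j \<alpha>')
    then show ?thesis using less.hyps[of \<alpha>'] step tdeg_upd[of j n \<alpha>'] by simp
  qed
qed

lemma deglex_irrefl: "\<not> deglex n \<alpha> \<alpha>"
  unfolding deglex_def by simp

lemma deglex_trans:
  assumes "deglex n \<alpha> \<beta>" "deglex n \<beta> \<gamma>"
  shows "deglex n \<alpha> \<gamma>"
proof -
  \<comment> \<open>The chain is decided at the earlier of the two deciding indices.\<close>
  have "\<exists>m. \<alpha> m < \<gamma> m \<and> (\<forall>i<m. \<alpha> i = \<gamma> i)"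
    if "\<alpha> k < \<beta> k" "\<forall>i<k. \<alpha> i = \<beta> i" "\<beta> l < \<gamma> l" "\<forall>i<l. \<beta> i = \<gamma> i" for k l
    using that by (intro exI[of _ "min k l"]) (cases k l rule: linorder_cases; auto simp: min_def)
  then have lex: "\<exists>k. \<alpha> k < \<gamma> k \<and> (\<forall>i<k. \<alpha> i = \<gamma> i)"
    if "\<exists>k. \<alpha> k < \<beta> k \<and> (\<forall>i<k. \<alpha> i = \<beta> i)" "\<exists>k. \<beta> k < \<gamma> k \<and> (\<forall>i<k. \<beta> i = \<gamma> i)"
    using that by (elim exE conjE)
  have le: "tdeg n \<alpha> \<le> tdeg n \<beta>" "tdeg n \<beta> \<le> tdeg n \<gamma>"
    using assms unfolding deglex_def by linarith+
  show ?thesis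
  proof (cases "tdeg n \<alpha> = tdeg n \<gamma>")
    case True
    then have "tdeg n \<alpha> = tdeg n \<beta>" "tdeg n \<beta> = tdeg n \<gamma>" using le by linarith+
    then show ?thesis using assms lex unfolding deglex_def by simp
  next
    case False
    then show ?thesis using le unfolding deglex_def by simp
  qed
qed

lemma deglex_total:
  assumes "\<alpha> \<noteq> \<beta>"
  shows "deglex n \<alpha> \<beta> \<or> deglex n \<beta> \<alpha>"
proof -
  have ex: "\<exists>k. \<alpha> k \<noteq> \<beta> k" using assms by auto
  define k where "k = (LEAST k. \<alpha> k \<noteq> \<beta> k)"
  have k: "\<alpha> k \<noteq> \<beta> k" using LeastI_ex[OF ex] unfolding k_def .
  have lt: "\<forall>i<k. \<alpha> i = \<beta> i" using not_less_Least unfolding k_def by blast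
  have "(\<exists>k. \<alpha> k < \<beta> k \<and> (\<forall>i<k. \<alpha> i = \<beta> i)) \<or> (\<exists>k. \<beta> k < \<alpha> k \<and> (\<forall>i<k. \<beta> i = \<alpha> i))"
  proof (cases "\<alpha> k < \<beta> k")
    case True
    then show ?thesis using lt by blast
  next
    case False
    then have "\<beta> k < \<alpha> k" using k by simp
    moreover have "\<forall>i<k. \<beta> i = \<alpha> i" using lt by simp
    ultimately show ?thesis by blast
  qed
  then show ?thesis
    unfolding deglex_def by (cases "tdeg n \<alpha>" "tdeg n \<beta>" rule: linorder_cases) simp_all
qed

lemma deglex_add: "deglex n \<alpha> \<beta> \<Longrightarrow> deglex n (\<lambda>i. \<alpha> i + \<gamma> i) (\<lambda>i. \<beta> i + \<gamma> i)"
  unfolding deglex_def tdeg_add by auto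

text \<open>Each coordinate of a predecessor is bounded by its total degree, hence by
  \<open>tdeg n \<alpha>\<close>.\<close>

lemma finite_deglex: "finite {\<gamma> \<in> exponents n. deglex n \<gamma> \<alpha>}"
proof (rule finite_subset)
  let ?B = "{\<gamma>. \<forall>i. (i \<in> {1..n} \<longrightarrow> \<gamma> i \<in> {..tdeg n \<alpha>}) \<and> (i \<notin> {1..n} \<longrightarrow> \<gamma> i = 0)}"
  show "finite ?B" by (rule finite_set_of_finite_funs) auto
  have "\<gamma> i \<le> tdeg n \<alpha>" if "deglex n \<gamma> \<alpha>" "i \<in> {1..n}" for \<gamma> i
  proof -
    have "\<gamma> i \<le> tdeg n \<gamma>" unfolding tdeg_def using that by (intro member_le_sum) auto
    then show ?thesis using that unfolding deglex_def by auto
  qed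
  then show "{\<gamma> \<in> exponents n. deglex n \<gamma> \<alpha>} \<subseteq> ?B" unfolding exponents_def by auto
qed

lemma deglex_imp_rank_less:
  assumes "\<alpha> \<in> exponents n" "deglex n \<alpha> \<beta>"
  shows "rank n \<alpha> < rank n \<beta>"
  unfolding rank_def
proof (rule psubset_card_mono[OF finite_deglex], rule psubsetI)
  show "{\<gamma> \<in> exponents n. deglex n \<gamma> \<alpha>} \<subseteq> {\<gamma> \<in> exponents n. deglex n \<gamma> \<beta>}"
    by (auto intro: deglex_trans[OF _ assms(2)])
  have "\<alpha> \<in> {\<gamma> \<in> exponents n. deglex n \<gamma> \<beta>}" "\<alpha> \<notin> {\<gamma> \<in> exponents n. deglex n \<gamma> \<alpha>}"
    using assms by (simp_all add: deglex_irrefl)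
  then show "{\<gamma> \<in> exponents n. deglex n \<gamma> \<alpha>} \<noteq> {\<gamma> \<in> exponents n. deglex n \<gamma> \<beta>}"
    by metis
qed

lemma rank_inj: "inj_on (rank n) (exponents n)"
proof (rule inj_onI, rule ccontr)
  fix \<alpha> \<beta> assume E: "\<alpha> \<in> exponents n" "\<beta> \<in> exponents n" and eq: "rank n \<alpha> = rank n \<beta>" and "\<alpha> \<noteq> \<beta>"
  then show False
    using deglex_total[of \<alpha> \<beta> n] deglex_imp_rank_less[OF E(1)] deglex_imp_rank_less[OF E(2)] by force
qed

lemma rank_less_imp_deglex:
  assumes "\<beta> \<in> exponents n" "rank n \<alpha> < rank n \<beta>"
  shows "deglex n \<alpha> \<beta>"
  using assms deglex_imp_rank_less[of \<beta> n \<alpha>] deglex_total[of \<alpha> \<beta> n] by (cases "\<alpha> = \<beta>") auto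

lemma tdeg_imp_rank_less:
  "\<alpha> \<in> exponents n \<Longrightarrow> tdeg n \<alpha> < tdeg n \<beta> \<Longrightarrow> rank n \<alpha> < rank n \<beta>"
  by (rule deglex_imp_rank_less) (auto simp: deglex_def)

lemma rank_add_less:
  assumes "\<alpha> \<in> exponents n" "\<beta> \<in> exponents n" "\<gamma> \<in> exponents n" "rank n \<alpha> < rank n \<beta>"
  shows "rank n (\<lambda>i. \<alpha> i + \<gamma> i) < rank n (\<lambda>i. \<beta> i + \<gamma> i)"
  using exponents_add[OF assms(1,3)] deglex_add[OF rank_less_imp_deglex[OF assms(2,4)]]
  by (rule deglex_imp_rank_less)

lemma rank_add_less2:
  assumes "\<alpha> \<in> exponents n" "\<beta> \<in> exponents n" "\<gamma> \<in> exponents n" "\<delta> \<in> exponents n"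
    and "rank n \<alpha> < rank n \<beta>" "rank n \<gamma> < rank n \<delta>"
  shows "rank n (\<lambda>i. \<alpha> i + \<gamma> i) < rank n (\<lambda>i. \<beta> i + \<delta> i)"
  \<comment> \<open>The intermediate exponent is \<open>\<beta> + \<gamma>\<close>.\<close>
  using rank_add_less[OF assms(1-3,5)] rank_add_less[OF assms(3,4,2,6)]
  by (simp add: add.commute)

section \<open>Monomials\<close>

lemma upt_split: "j \<in> {1..n} \<Longrightarrow> [1..<Suc n] = [1..<j] @ j # [Suc j..<Suc n]"
  using upt_add_eq_append[of 1 j "Suc n - j"] by (simp add: upt_rec[of j])

lemma prod_list_eq_1: "\<forall>y\<in>set ys. y = (1::'a::monoid_mult) \<Longrightarrow> prod_list ys = 1"
  by (induction ys) auto

text \<open>All factors to the left of position \<open>j\<close> are 1, so \<open>x j\<close> merges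
  with the first power that counts.\<close>

lemma monomial_upd:
  assumes "j \<in> {1..n}" "\<forall>i<j. \<alpha> i = 0"
  shows "x j * monomial n x \<alpha> = monomial n x (\<alpha>(j := Suc (\<alpha> j)))"
proof -
  \<comment> \<open>The part to the right of position \<open>j\<close>, which an update at
    \<open>j\<close> does not touch.\<close>
  let ?T = "\<lambda>\<alpha>. prod_list (map (\<lambda>i. x i ^ \<alpha> i) [Suc j..<Suc n])"
  have factor: "monomial n x \<beta> = x j ^ \<beta> j * ?T \<beta>" if "\<forall>i<j. \<beta> i = 0" for \<beta>
    using that prod_list_eq_1[of "map (\<lambda>i. x i ^ \<beta> i) [1..<j]"]
    unfolding monomial_def upt_split[OF assms(1)] by auto
  have "x j * monomial n x \<alpha> = x j ^ Suc (\<alpha> j) * ?T \<alpha>"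
    unfolding factor[OF assms(2)] by (simp add: mult.assoc)
  also have "?T \<alpha> = ?T (\<alpha>(j := Suc (\<alpha> j)))"
    by (intro arg_cong[where f = prod_list] map_cong) auto
  also have "x j ^ Suc (\<alpha> j) * \<dots> = monomial n x (\<alpha>(j := Suc (\<alpha> j)))"
    using assms(2) by (subst factor) auto
  finally show ?thesis .
qed

lemma endo_power_zero: "endo_power n \<sigma> (\<lambda>i. 0) = id"
proof -
  have "foldr (\<circ>) (map (\<lambda>i. id) ks) id = id" for ks :: "nat list" by (induction ks) auto
  then show ?thesis unfolding endo_power_def by (simp del: upt_Suc)
qed

lemma foldr_comp_id: "\<forall>h\<in>set hs. h = id \<Longrightarrow> foldr (\<circ>) hs g = g"
  by (induction hs) auto

text \<open>The composition has the same order as the factors of a monomial, so the new map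
  \<open>\<sigma> j\<close> is the outermost one.\<close>

lemma endo_power_upd:
  assumes "j \<in> {1..n}" "\<forall>i<j. \<alpha> i = 0"
  shows "endo_power n \<sigma> (\<alpha>(j := Suc (\<alpha> j))) r = \<sigma> j (endo_power n \<sigma> \<alpha> r)"
proof -
  let ?T = "\<lambda>\<alpha>. foldr (\<circ>) (map (\<lambda>i. \<sigma> i ^^ \<alpha> i) [Suc j..<Suc n]) id"
  have factor: "endo_power n \<sigma> \<beta> = (\<sigma> j ^^ \<beta> j) \<circ> ?T \<beta>" if "\<forall>i<j. \<beta> i = 0" for \<beta>
    using that foldr_comp_id[of "map (\<lambda>i. \<sigma> i ^^ \<beta> i) [1..<j]"]
    unfolding endo_power_def upt_split[OF assms(1)] by auto
  have "\<sigma> j (endo_power n \<sigma> \<alpha> r) = ((\<sigma> j ^^ Suc (\<alpha> j)) \<circ> ?T \<alpha>) r"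
    unfolding factor[OF assms(2)] by simp
  also have "?T \<alpha> = ?T (\<alpha>(j := Suc (\<alpha> j)))"
    by (intro arg_cong[where f = "\<lambda>hs. foldr (\<circ>) hs id"] map_cong) auto
  also have "((\<sigma> j ^^ Suc (\<alpha> j)) \<circ> \<dots>) r = endo_power n \<sigma> (\<alpha>(j := Suc (\<alpha> j))) r"
    using assms(2) by (subst factor) auto
  finally show ?thesis by (rule sym)
qed

section \<open>Leading terms\<close>

locale skew_PBW =
  fixes R :: "'a::ring_1 set" and n :: nat and x :: "nat \<Rightarrow> 'a"
    and \<sigma> \<delta> :: "nat \<Rightarrow> 'a \<Rightarrow> 'a"
  assumes extension: "skew_PBW_extension R n x"
    and maps: "associated_maps R n x \<sigma> \<delta>"
begin

abbreviation "E \<equiv> exponents n"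
abbreviation "mon \<equiv> monomial n x"

text \<open>The left \<open>R\<close>-span of the monomials with exponents in \<open>P\<close>.
  Adding one term at a time, with repetitions allowed, lets closure properties follow by rule
  induction.\<close>

inductive_set lspan :: "(nat \<Rightarrow> nat) set \<Rightarrow> 'a set" for P where
  zero: "0 \<in> lspan P"
| add: "\<gamma> \<in> P \<Longrightarrow> r \<in> R \<Longrightarrow> s \<in> lspan P \<Longrightarrow> r * mon \<gamma> + s \<in> lspan P"

abbreviation "below \<alpha> \<equiv> lspan {\<gamma> \<in> E. rank n \<gamma> < rank n \<alpha>}"
abbreviation "degree_less d \<equiv> lspan {\<gamma> \<in> E. tdeg n \<gamma> < d}"

text \<open>The coefficient \<open>a\<close> may be zero: the leading term is taken relative to a
  prescribed exponent, and proofs then show that \<open>a\<close> vanishes.\<close>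

definition has_lead :: "'a \<Rightarrow> (nat \<Rightarrow> nat) \<Rightarrow> 'a \<Rightarrow> bool" where
  "has_lead f \<alpha> a \<longleftrightarrow> \<alpha> \<in> E \<and> a \<in> R \<and> f - a * mon \<alpha> \<in> below \<alpha>"

lemma subring: "is_subring R"
  using extension unfolding skew_PBW_extension_def by blast

lemmas closed = subring_closed[OF subring]

lemma sigma:
  assumes "i \<in> {1..n}"
  shows "r \<in> R \<Longrightarrow> \<sigma> i r \<in> R" "\<sigma> i 1 = 1"
    "r \<in> R \<Longrightarrow> s \<in> R \<Longrightarrow> \<sigma> i (r * s) = \<sigma> i r * \<sigma> i s"
    "r \<in> R \<Longrightarrow> \<delta> i r \<in> R" "r \<in> R \<Longrightarrow> x i * r = \<sigma> i r * x i + \<delta> i r"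
  using maps assms unfolding associated_maps_def is_endomorphism_def is_derivation_def by blast+

lemma endo_power_closed: "\<alpha> \<in> E \<Longrightarrow> r \<in> R \<Longrightarrow> endo_power n \<sigma> \<alpha> r \<in> R"
  by (induction \<alpha> rule: exponents_induct) (simp_all add: endo_power_zero endo_power_upd sigma)

lemma endo_power_mult:
  "\<alpha> \<in> E \<Longrightarrow> r \<in> R \<Longrightarrow> s \<in> R \<Longrightarrow>
    endo_power n \<sigma> \<alpha> (r * s) = endo_power n \<sigma> \<alpha> r * endo_power n \<sigma> \<alpha> s"
  by (induction \<alpha> rule: exponents_induct)
    (simp_all add: endo_power_zero endo_power_upd sigma endo_power_closed)

section \<open>Left spans of monomials\<close>

lemma lspan_mono: "s \<in> lspan P \<Longrightarrow> P \<subseteq> Q \<Longrightarrow> s \<in> lspan Q"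
  by (induction rule: lspan.induct) (auto intro: lspan.intros)

lemma lspan_add: "s \<in> lspan P \<Longrightarrow> t \<in> lspan P \<Longrightarrow> s + t \<in> lspan P"
  by (induction rule: lspan.induct) (auto simp: add.assoc intro: lspan.intros)

lemma lspan_scale: "s \<in> lspan P \<Longrightarrow> r \<in> R \<Longrightarrow> r * s \<in> lspan P"
  by (induction rule: lspan.induct)
    (auto simp: distrib_left mult.assoc[symmetric] intro: lspan.intros closed)

lemma lspan_term: "\<gamma> \<in> P \<Longrightarrow> r \<in> R \<Longrightarrow> r * mon \<gamma> \<in> lspan P"
  using lspan.add[of \<gamma> P r 0] lspan.zero by simp

lemma lspan_mon: "\<gamma> \<in> P \<Longrightarrow> mon \<gamma> \<in> lspan P"
  using lspan_term[of \<gamma> P 1] closed by simp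

lemma lspan_sum: "(\<And>i. i \<in> I \<Longrightarrow> s i \<in> lspan P) \<Longrightarrow> sum s I \<in> lspan P"
  by (induction I rule: infinite_finite_induct) (auto intro: lspan_add lspan.zero)

lemma lspan_uminus: "s \<in> lspan P \<Longrightarrow> - s \<in> lspan P"
  using lspan_scale[of s P "0 - 1"] closed(3)[OF closed(1,2)] by simp

text \<open>Coefficients of the left factor can be pulled out, but a coefficient \<open>d\<close> of
  the right factor stays between two monomials and must be moved past
  \<open>mon \<gamma>\<close>.\<close>

lemma lspan_mult:
  assumes "f \<in> lspan P" "g \<in> lspan Q"
    and "\<And>\<gamma> d \<epsilon>. \<gamma> \<in> P \<Longrightarrow> d \<in> R \<Longrightarrow> \<epsilon> \<in> Q \<Longrightarrow> mon \<gamma> * (d * mon \<epsilon>) \<in> lspan T"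
  shows "f * g \<in> lspan T"
proof -
  have mon: "mon \<gamma> * g \<in> lspan T" if "\<gamma> \<in> P" for \<gamma>
    using assms(2) that by induction (auto simp: distrib_left intro: lspan_add lspan.zero assms(3))
  show ?thesis
    using assms(1)
    by induction (auto simp: distrib_right mult.assoc intro: lspan_add lspan.zero lspan_scale mon)
qed

text \<open>Collecting all terms with exponent \<open>\<beta>\<close>; this later extracts the
  coefficient of the highest monomial.\<close>

lemma lspan_insert:
  assumes "s \<in> lspan P" "P \<subseteq> insert \<beta> Q"
  shows "\<exists>b\<in>R. s - b * mon \<beta> \<in> lspan Q"
  using assms
proof induction
  case zero
  show ?case by (rule bexI[of _ 0]) (simp_all add: lspan.zero closed)
next
  case (add \<gamma> r s)
  then obtain b where b: "b \<in> R" "s - b * mon \<beta> \<in> lspan Q" by blast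
  show ?case
  proof (cases "\<gamma> = \<beta>")
    case True
    then show ?thesis
      using b add by (intro bexI[of _ "r + b"]) (simp_all add: distrib_right closed)
  next
    case False
    then show ?thesis
      using b add lspan.add[of \<gamma> Q r "s - b * mon \<beta>"]
      by (intro bexI[of _ b]) (auto simp: algebra_simps)
  qed
qed

text \<open>Merging repeated exponents yields a single coefficient function, the form in which
  \<open>left_basis\<close> states independence.\<close>

lemma lspan_explicit:
  assumes "s \<in> lspan P"
  shows "\<exists>S c. finite S \<and> S \<subseteq> P \<and> (\<forall>i\<in>S. c i \<in> R) \<and> s = (\<Sum>i\<in>S. c i * mon i)"
  using assms
proof induction
  case zero
  show ?case by (intro exI[of _ "{}"]) auto
next
  case (add \<gamma> r s)
  then obtain S c where S: "finite S" "S \<subseteq> P" "\<forall>i\<in>S. c i \<in> R" "s = (\<Sum>i\<in>S. c i * mon i)"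
    by blast
  show ?case
  proof (cases "\<gamma> \<in> S")
    case True
    let ?c = "c(\<gamma> := r + c \<gamma>)"
    have "(\<Sum>i\<in>S. ?c i * mon i) = r * mon \<gamma> + s"
      using True S(1) unfolding S(4) by (simp add: sum.remove[of S \<gamma>] distrib_right add.assoc)
    then show ?thesis
      using S True add by (intro exI[of _ S] exI[of _ ?c]) (auto intro: closed)
  next
    case False
    have "(\<Sum>i\<in>S. (c(\<gamma> := r)) i * mon i) = s"
      unfolding S(4) using False by (intro sum.cong) auto
    then show ?thesis
      using S False add by (intro exI[of _ "insert \<gamma> S"] exI[of _ "c(\<gamma> := r)"]) auto
  qed
qed

lemma lspan_UNIV: "f \<in> lspan E"
proof -
  have "\<exists>S c. finite S \<and> S \<subseteq> E \<and> (\<forall>i\<in>S. c i \<in> R) \<and> f = (\<Sum>i\<in>S. c i * mon i)"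
    using extension unfolding skew_PBW_extension_def left_basis_def by blast
  then show ?thesis by (auto intro!: lspan_sum lspan_term)
qed

lemma independent:
  assumes "a \<in> R" "\<alpha> \<in> E" "P \<subseteq> E - {\<alpha>}" "a * mon \<alpha> \<in> lspan P"
  shows "a = 0"
proof -
  have "- (a * mon \<alpha>) \<in> lspan P" using assms(4) by (rule lspan_uminus)
  from lspan_explicit[OF this] obtain S c where S: "finite S" "S \<subseteq> P" "\<forall>i\<in>S. c i \<in> R"
    "- (a * mon \<alpha>) = (\<Sum>i\<in>S. c i * mon i)"
    by (elim exE conjE) (rule that)
  have nin: "\<alpha> \<notin> S" using S assms(3) by auto
  \<comment> \<open>Moving \<open>a * mon \<alpha>\<close> to the other side gives a vanishing
    combination with coefficient \<open>a\<close> at the fresh exponent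
    \<open>\<alpha>\<close>.\<close>
  let ?c = "c(\<alpha> := a)"
  have "(\<Sum>i\<in>S. ?c i * mon i) = - (a * mon \<alpha>)"
    unfolding S(4) using nin by (intro sum.cong) auto
  then have sum0: "(\<Sum>i\<in>insert \<alpha> S. ?c i * mon i) = 0" using S(1) nin by simp
  have basis: "left_basis R E mon" using extension unfolding skew_PBW_extension_def by blast
  have indep: "\<forall>i\<in>T. d i = 0"
    if "finite T" "T \<subseteq> E" "\<forall>i\<in>T. d i \<in> R" "(\<Sum>i\<in>T. d i * mon i) = 0" for T d
    using basis that unfolding left_basis_def by blast
  have "\<forall>i\<in>insert \<alpha> S. ?c i = 0"
  proof (rule indep[OF _ _ _ sum0])
    show "finite (insert \<alpha> S)" "insert \<alpha> S \<subseteq> E" "\<forall>i\<in>insert \<alpha> S. ?c i \<in> R"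
      using S(1-3) assms(1-3) by auto
  qed
  then show ?thesis by simp
qed

lemma has_lead_0:
  assumes "has_lead 0 \<alpha> a"
  shows "a = 0"
proof (rule independent)
  show "a * mon \<alpha> \<in> below \<alpha>"
    using assms lspan_uminus[of "0 - a * mon \<alpha>" "{\<gamma> \<in> E. rank n \<gamma> < rank n \<alpha>}"]
    unfolding has_lead_def by simp
qed (use assms in \<open>auto simp: has_lead_def\<close>)

section \<open>Degree estimates for generators and affine forms\<close>

lemma degree_less_mono: "s \<in> degree_less d \<Longrightarrow> d \<le> e \<Longrightarrow> s \<in> degree_less e"
  by (erule lspan_mono) auto

lemma degree_less_below: "s \<in> degree_less (tdeg n \<alpha>) \<Longrightarrow> s \<in> below \<alpha>"
  by (erule lspan_mono) (auto intro: tdeg_imp_rank_less)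

text \<open>Moving \<open>x i\<close> past a coefficient \<open>r\<close> leaves
  \<open>\<delta> i r\<close>, which does not raise the degree, so only products
  \<open>x i * mon \<gamma>\<close> matter. Their bound is a premise because it is proved later by
  an induction that uses this reduction.\<close>

lemma x_mult_degree_less_mon:
  assumes i: "i \<in> {1..n}" and s: "s \<in> degree_less d"
    and mon: "\<And>\<gamma>. \<gamma> \<in> E \<Longrightarrow> tdeg n \<gamma> < d \<Longrightarrow> x i * mon \<gamma> \<in> degree_less (Suc d)"
  shows "x i * s \<in> degree_less (Suc d)"
  using s
proof induction
  case zero
  show ?case by (simp add: lspan.zero)
next
  case (add \<gamma> r s)
  have "x i * (r * mon \<gamma> + s) = \<sigma> i r * (x i * mon \<gamma>) + \<delta> i r * mon \<gamma> + x i * s"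
    using sigma(5)[OF i \<open>r \<in> R\<close>]
    by (simp add: distrib_left distrib_right mult.assoc[symmetric])
  also have "\<dots> \<in> degree_less (Suc d)"
  proof (intro lspan_add)
    show "\<sigma> i r * (x i * mon \<gamma>) \<in> degree_less (Suc d)"
      using add by (intro lspan_scale mon sigma i) auto
    show "\<delta> i r * mon \<gamma> \<in> degree_less (Suc d)"
      using add by (intro lspan_term sigma i) auto
  qed (rule add.IH)
  finally show ?case .
qed

text \<open>Affine forms are the remainders of reordering two generators; their products with
  \<open>t\<close> are left combinations of \<open>t\<close> and the \<open>x k * t\<close>.\<close>

lemma affine_forms_mult:
  assumes "s \<in> affine_forms R n x" "t \<in> lspan P"
    and "\<And>k. k \<in> {1..n} \<Longrightarrow> x k * t \<in> lspan P"
  shows "s * t \<in> lspan P"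
proof -
  obtain r where r: "s = r 0 + (\<Sum>k=1..n. r k * x k)" "\<forall>k\<le>n. r k \<in> R"
    using assms(1) unfolding affine_forms_def by blast
  have "s * t = r 0 * t + (\<Sum>k=1..n. r k * (x k * t))"
    unfolding r(1) by (simp add: distrib_right sum_distrib_right mult.assoc)
  also have "\<dots> \<in> lspan P"
    using r(2) by (intro lspan_add lspan_sum lspan_scale[OF assms(2)] lspan_scale[OF assms(3)]) auto
  finally show ?thesis .
qed

lemma affine_forms_degree_less:
  assumes "s \<in> affine_forms R n x"
  shows "s \<in> degree_less 2"
proof -
  \<comment> \<open>The factor 1 makes \<open>s\<close> a product to which
    \<open>affine_forms_mult\<close> applies.\<close>
  have "s * 1 \<in> degree_less 2"
  proof (rule affine_forms_mult[OF assms])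
    have z: "(\<lambda>i. 0) \<in> E" "tdeg n (\<lambda>i. 0) = 0" by (simp_all add: exponents_def tdeg_def)
    then show "1 \<in> degree_less 2" using lspan_mon[of "\<lambda>i. 0"] by (simp add: monomial_zero)
    fix k assume k: "k \<in> {1..n}"
    have "x k * 1 = mon ((\<lambda>i. 0)(k := Suc 0))"
      using monomial_upd[OF k, of "\<lambda>i. 0" x] by (simp add: monomial_zero)
    then show "x k * 1 \<in> degree_less 2"
      using z exponents_upd[OF z(1) k] tdeg_upd[OF k, of "\<lambda>i. 0"] by (auto intro!: lspan_mon)
  qed
  then show ?thesis by simp
qed

end

text \<open>A right inverse in \<open>R\<close> is what cancelling \<open>u\<close> in
  \<open>r * u = 0\<close> takes, and this property passes to products and to images under the
  \<open>\<sigma> i\<close>.\<close>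

definition right_units :: "'a::ring_1 set \<Rightarrow> 'a set" where
  "right_units R = {u \<in> R. \<exists>v\<in>R. u * v = 1}"

locale rigid_skew_PBW = skew_PBW +
  assumes rigid: "Sigma_rigid R n \<sigma>"
begin

section \<open>Consequences of rigidity and invertible constants\<close>

lemma rigidD: "r \<in> R \<Longrightarrow> \<alpha> \<in> E \<Longrightarrow> r * endo_power n \<sigma> \<alpha> r = 0 \<Longrightarrow> r = 0"
  using rigid unfolding Sigma_rigid_def by blast

lemma R_reduced: "r \<in> R \<Longrightarrow> r * r = 0 \<Longrightarrow> r = 0"
  using rigidD[of r "\<lambda>i. 0"] by (simp add: endo_power_zero exponents_def)

text \<open>The argument of \<open>reduced_insert\<close> inside \<open>R\<close>; reducedness of
  the whole ring is derived only later.\<close>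

lemma R_reversible:
  assumes "a \<in> R" "b \<in> R" "a * b = 0"
  shows "b * a = 0"
proof -
  have "(b * a) * (b * a) = b * (a * b) * a" by (simp only: mult.assoc)
  also have "\<dots> = 0" using assms(3) by simp
  finally show ?thesis by (rule R_reduced[OF closed(4)[OF assms(2,1)]])
qed

text \<open>Rigidity is applied to \<open>b * a\<close>: since
  \<open>\<sigma>\<^sup>\<alpha>\<close> is multiplicative, the vanishing product appears in the
  middle of \<open>b * a * \<sigma>\<^sup>\<alpha>(b * a)\<close>.\<close>

lemma rigid_mult:
  assumes "a \<in> R" "b \<in> R" "\<alpha> \<in> E" "a * endo_power n \<sigma> \<alpha> b = 0"
  shows "a * b = 0"
proof -
  have "(b * a) * endo_power n \<sigma> \<alpha> (b * a) = b * (a * endo_power n \<sigma> \<alpha> b) * endo_power n \<sigma> \<alpha> a"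
    unfolding endo_power_mult[OF assms(3,2,1)] by (simp only: mult.assoc)
  also have "\<dots> = 0" unfolding assms(4) by simp
  finally have "b * a = 0" by (rule rigidD[OF closed(4)[OF assms(2,1)] assms(3)])
  then show ?thesis by (rule R_reversible[OF assms(2,1)])
qed

lemma right_units_mult: "u \<in> right_units R \<Longrightarrow> v \<in> right_units R \<Longrightarrow> u * v \<in> right_units R"
proof -
  assume "u \<in> right_units R" "v \<in> right_units R"
  then obtain u' v' where uv: "u \<in> R" "v \<in> R" "u' \<in> R" "v' \<in> R" "u * u' = 1" "v * v' = 1"
    unfolding right_units_def by blast
  have "(u * v) * (v' * u') = u * (v * v') * u'" by (simp only: mult.assoc)
  also have "\<dots> = 1" using uv by simp
  finally show "u * v \<in> right_units R"
    using closed(4)[OF uv(1,2)] closed(4)[OF uv(4,3)] unfolding right_units_def by blast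
qed

lemma right_units_sigma:
  assumes i: "i \<in> {1..n}" and u: "u \<in> right_units R"
  shows "\<sigma> i u \<in> right_units R"
proof -
  obtain v where v: "u \<in> R" "v \<in> R" "u * v = 1" using u unfolding right_units_def by blast
  have "\<sigma> i u * \<sigma> i v = 1" using sigma(3)[OF i v(1,2)] v(3) sigma(2)[OF i] by simp
  then show ?thesis using sigma(1)[OF i v(1)] sigma(1)[OF i v(2)] unfolding right_units_def by blast
qed

lemma right_units_cancel:
  assumes "u \<in> right_units R" "r * u = 0"
  shows "r = 0"
proof -
  obtain v where "u * v = 1" using assms(1) unfolding right_units_def by blast
  then have "r = r * u * v" by (simp add: mult.assoc)
  then show ?thesis using assms(2) by simp
qed

text \<open>
  Reordering \<open>x\<^sub>i x\<^sub>j\<close> twice shows that the constants satisfy \<open>c' c = 1\<close>; a reduced ring is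
  Dedekind finite, so \<open>c\<close> is also right invertible.
\<close>

lemma commutation:
  assumes i: "i \<in> {1..n}" and j: "j \<in> {1..n}" and ij: "i < j"
  shows "\<exists>c\<in>right_units R. x j * x i - c * x i * x j \<in> affine_forms R n x"
proof -
  obtain c where c: "c \<in> R" "x j * x i - c * x i * x j \<in> affine_forms R n x"
    using extension i j unfolding skew_PBW_extension_def by blast
  obtain c' where c': "c' \<in> R" "x i * x j - c' * x j * x i \<in> affine_forms R n x"
    using extension i j unfolding skew_PBW_extension_def by blast
  define \<alpha> where "\<alpha> = (\<lambda>i. 0::nat)(j := Suc 0)"
  define \<beta> where "\<beta> = \<alpha>(i := Suc (\<alpha> i))"
  have z: "(\<lambda>i. 0) \<in> E" "tdeg n (\<lambda>i. 0) = 0" by (simp_all add: exponents_def tdeg_def)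
  have \<alpha>: "\<alpha> \<in> E" "tdeg n \<alpha> = 1" "mon \<alpha> = x j"
    using exponents_upd[OF z(1) j] tdeg_upd[OF j, of "\<lambda>i. 0"] z monomial_upd[OF j, of "\<lambda>i. 0" x]
    by (simp_all add: \<alpha>_def monomial_zero)
  \<comment> \<open>Because \<open>i < j\<close>, the product \<open>x i * x j\<close> is itself a
    basis monomial, with exponent \<open>\<beta>\<close> of degree 2.\<close>
  have "\<forall>k<i. \<alpha> k = 0" using ij by (simp add: \<alpha>_def)
  then have \<beta>: "\<beta> \<in> E" "tdeg n \<beta> = 2" "mon \<beta> = x i * x j"
    using exponents_upd[OF \<alpha>(1) i] tdeg_upd[OF i, of \<alpha>] \<alpha> monomial_upd[OF i, of \<alpha> x]
    by (simp_all add: \<beta>_def)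
  have "(1 - c' * c) * mon \<beta> = (x i * x j - c' * x j * x i) + c' * (x j * x i - c * x i * x j)"
    unfolding \<beta>(3) by (simp add: algebra_simps)
  also have "\<dots> \<in> degree_less 2"
    using c c' by (intro lspan_add lspan_scale affine_forms_degree_less)
  finally have "1 - c' * c = 0"
    by (rule independent[rotated 3]) (use c c' closed \<beta> in auto)
  then have cc: "c' * c = 1" by simp
  let ?e = "1 - c * c'"
  have e: "?e \<in> R" using c c' closed by simp
  \<comment> \<open>From \<open>e * c = 0\<close> reversibility gives \<open>c * e = 0\<close>, and
    multiplying by \<open>c'\<close> on the left gives \<open>e = 0\<close>.\<close>
  have "?e * c = c - c * (c' * c)" by (simp add: algebra_simps)
  then have "c * ?e = 0" using cc R_reversible[OF e c(1)] by simp
  then have "(c' * c) * ?e = 0" by (simp add: mult.assoc)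
  then have "c * c' = 1" using cc by simp
  then show ?thesis using c c' unfolding right_units_def by blast
qed

section \<open>Leading terms of products of monomials\<close>

lemma x_mult_degree_less_lead:
  assumes i: "i \<in> {1..n}" and s: "s \<in> degree_less d"
    and lead: "\<And>\<gamma>. \<gamma> \<in> E \<Longrightarrow> tdeg n \<gamma> < d \<Longrightarrow> \<exists>u\<in>right_units R.
      x i * mon \<gamma> - u * mon (\<gamma>(i := Suc (\<gamma> i))) \<in> degree_less (Suc (tdeg n \<gamma>))"
  shows "x i * s \<in> degree_less (Suc d)"
proof (rule x_mult_degree_less_mon[OF i s])
  fix \<gamma> assume \<gamma>: "\<gamma> \<in> E" "tdeg n \<gamma> < d"
  obtain u where u: "u \<in> right_units R"
    "x i * mon \<gamma> - u * mon (\<gamma>(i := Suc (\<gamma> i))) \<in> degree_less (Suc (tdeg n \<gamma>))"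
    using lead[OF \<gamma>] by blast
  have "u * mon (\<gamma>(i := Suc (\<gamma> i))) \<in> degree_less (Suc d)"
    using u(1) \<gamma> exponents_upd[OF \<gamma>(1) i] tdeg_upd[OF i, of \<gamma>]
    by (intro lspan_term) (auto simp: right_units_def)
  then show "x i * mon \<gamma> \<in> degree_less (Suc d)"
    using lspan_add[OF degree_less_mono[OF u(2), of "Suc d"]] \<gamma> by fastforce
qed

text \<open>Induction on the degree. If \<open>i\<close> is at most the first index \<open>j\<close>
  of \<open>\<gamma>\<close>, then \<open>x i\<close> fits in front. Otherwise
  \<open>mon \<gamma> = x j * mon \<gamma>'\<close>; after swapping \<open>x i\<close> and
  \<open>x j\<close>, the induction hypothesis treats \<open>x i * mon \<gamma>'\<close>, and
  \<open>x j\<close> is then put in front.\<close>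

lemma x_mult_mon:
  assumes "\<gamma> \<in> E" "i \<in> {1..n}"
  shows "\<exists>u\<in>right_units R. x i * mon \<gamma> - u * mon (\<gamma>(i := Suc (\<gamma> i))) \<in> degree_less (Suc (tdeg n \<gamma>))"
  using assms
proof (induction "tdeg n \<gamma>" arbitrary: \<gamma> i rule: less_induct)
  case less
  note i = \<open>i \<in> {1..n}\<close>
  have one: "1 \<in> right_units R" unfolding right_units_def using closed by auto
  have top: "?case" if "\<forall>k<i. \<gamma> k = 0"
    by (rule bexI[OF _ one]) (simp add: monomial_upd[OF i that] lspan.zero)
  \<comment> \<open>The induction hypothesis, for every generator, supplies the premise of
    \<open>x_mult_degree_less_lead\<close> up to the degree of \<open>\<gamma>\<close>.\<close>
  have up: "x k * s \<in> degree_less (Suc d)"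
    if k: "k \<in> {1..n}" and s: "s \<in> degree_less d" and d: "d \<le> tdeg n \<gamma>" for k s d
    by (rule x_mult_degree_less_lead[OF k s])
      (rule less.hyps[OF less_le_trans[OF _ d] _ k])
  from \<open>\<gamma> \<in> E\<close> show ?case
  proof (cases rule: exponents_cases)
    case 1
    then show ?thesis using top by simp
  next
    case (2 j \<gamma>')
    note j = 2(1) and mon_\<gamma> = monomial_upd[OF 2(1,3), of x, folded 2(4)]
    have deg: "tdeg n \<gamma> = Suc (tdeg n \<gamma>')" using 2 tdeg_upd by simp
    show ?thesis
    proof (cases "i \<le> j")
      case True
      then show ?thesis using top 2 by simp
    next
      case False
      then have ji: "j < i" by simp
      obtain c where c: "c \<in> right_units R" "x i * x j - c * x j * x i \<in> affine_forms R n x"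
        using commutation[OF j i ji] by blast
      let ?\<eta> = "\<gamma>'(i := Suc (\<gamma>' i))"
      obtain u where u: "u \<in> right_units R" "x i * mon \<gamma>' - u * mon ?\<eta> \<in> degree_less (tdeg n \<gamma>)"
        using less.hyps[OF _ 2(2) i] deg by auto
      have uR: "c \<in> R" "u \<in> R" using c u unfolding right_units_def by auto
      have \<eta>: "?\<eta> \<in> E" "tdeg n ?\<eta> = tdeg n \<gamma>"
        using exponents_upd[OF 2(2) i] tdeg_upd[OF i] deg by auto
      \<comment> \<open>As \<open>j < i\<close>, the index \<open>j\<close> still precedes or equals
        all indices in \<open>?\<eta>\<close>, so \<open>x j\<close> can be put in front.\<close>
      have "\<forall>k<j. ?\<eta> k = 0" using 2(3) ji by simp
      then have "x j * mon ?\<eta> = mon (?\<eta>(j := Suc (?\<eta> j)))" by (rule monomial_upd[OF j])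
      also have "?\<eta>(j := Suc (?\<eta> j)) = \<gamma>(i := Suc (\<gamma> i))" using ji 2(4) by auto
      finally have xj: "x j * mon ?\<eta> = mon (\<gamma>(i := Suc (\<gamma> i)))" .
      have "x j * (u * mon ?\<eta>) = (\<sigma> j u * x j + \<delta> j u) * mon ?\<eta>"
        using sigma(5)[OF j uR(2)] by (simp add: mult.assoc[symmetric])
      then have xju: "x j * (u * mon ?\<eta>) = \<sigma> j u * mon (\<gamma>(i := Suc (\<gamma> i))) + \<delta> j u * mon ?\<eta>"
        using xj by (simp add: distrib_right mult.assoc)
      \<comment> \<open>The new unit is \<open>c * \<sigma> j u\<close>. The three errors come from
        the swap, from the induction hypothesis and from moving \<open>u\<close> past
        \<open>x j\<close>.\<close>
      have "x i * mon \<gamma> - c * \<sigma> j u * mon (\<gamma>(i := Suc (\<gamma> i))) =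
        (x i * x j - c * x j * x i) * mon \<gamma>' + c * (x j * (x i * mon \<gamma>' - u * mon ?\<eta>))
          + c * (x j * (u * mon ?\<eta>) - \<sigma> j u * mon (\<gamma>(i := Suc (\<gamma> i))))"
        unfolding mon_\<gamma>[symmetric] by (simp add: algebra_simps)
      also have "\<dots> = (x i * x j - c * x j * x i) * mon \<gamma>'
          + c * (x j * (x i * mon \<gamma>' - u * mon ?\<eta>)) + c * (\<delta> j u * mon ?\<eta>)"
        unfolding xju by simp
      also have "\<dots> \<in> degree_less (Suc (tdeg n \<gamma>))"
      proof (intro lspan_add)
        have \<gamma>': "mon \<gamma>' \<in> degree_less (tdeg n \<gamma>)" using 2(2) deg by (intro lspan_mon) auto
        show "(x i * x j - c * x j * x i) * mon \<gamma>' \<in> degree_less (Suc (tdeg n \<gamma>))"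
          by (rule affine_forms_mult[OF c(2) degree_less_mono[OF \<gamma>'] up[OF _ \<gamma>']]) auto
        have "x j * (x i * mon \<gamma>' - u * mon ?\<eta>) \<in> degree_less (Suc (tdeg n \<gamma>))"
          by (rule up[OF j u(2)]) simp
        then show "c * (x j * (x i * mon \<gamma>' - u * mon ?\<eta>)) \<in> degree_less (Suc (tdeg n \<gamma>))"
          by (rule lspan_scale[OF _ uR(1)])
        have "\<delta> j u * mon ?\<eta> \<in> degree_less (Suc (tdeg n \<gamma>))"
          using \<eta> sigma(4)[OF j uR(2)] by (intro lspan_term) auto
        then show "c * (\<delta> j u * mon ?\<eta>) \<in> degree_less (Suc (tdeg n \<gamma>))"
          by (rule lspan_scale[OF _ uR(1)])
      qed
      finally show ?thesis
        using right_units_mult[OF c(1) right_units_sigma[OF j u(1)]] by blast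
    qed
  qed
qed

lemma x_mult_degree_less:
  assumes "i \<in> {1..n}" "s \<in> degree_less d"
  shows "x i * s \<in> degree_less (Suc d)"
  by (rule x_mult_degree_less_lead[OF assms]) (rule x_mult_mon[OF _ assms(1)])

text \<open>Each further generator \<open>x j\<close> applies \<open>\<sigma> j\<close> to the
  coefficient, including the unit \<open>u\<close>, and contributes a unit \<open>v\<close> from
  sorting \<open>x j\<close> into the monomial. The \<open>\<delta> j\<close> part has smaller
  degree.\<close>

lemma mon_mult_term:
  assumes "\<alpha> \<in> E" "\<beta> \<in> E" "b \<in> R"
  shows "\<exists>u\<in>right_units R. mon \<alpha> * (b * mon \<beta>) - endo_power n \<sigma> \<alpha> b * u * mon (\<lambda>i. \<alpha> i + \<beta> i)
    \<in> degree_less (tdeg n \<alpha> + tdeg n \<beta>)"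
  using assms(1)
proof (induction \<alpha> rule: exponents_induct)
  case zero
  show ?case
    by (rule bexI[of _ 1])
      (auto simp: monomial_zero endo_power_zero right_units_def closed lspan.zero)
next
  case (upd \<alpha> j)
  note j = \<open>j \<in> {1..n}\<close>
  let ?\<eta> = "\<lambda>i. \<alpha> i + \<beta> i" and ?\<alpha> = "\<alpha>(j := Suc (\<alpha> j))"
  let ?d = "tdeg n \<alpha> + tdeg n \<beta>" and ?s = "endo_power n \<sigma> \<alpha> b"
  have \<eta>: "?\<eta> \<in> E" "tdeg n ?\<eta> = ?d" using exponents_add upd(1) assms(2) tdeg_add by auto
  have \<eta>': "?\<eta>(j := Suc (?\<eta> j)) = (\<lambda>i. ?\<alpha> i + \<beta> i)" by auto
  obtain u where u: "u \<in> right_units R" "mon \<alpha> * (b * mon \<beta>) - ?s * u * mon ?\<eta> \<in> degree_less ?d"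
    using upd.IH by blast
  obtain v where v: "v \<in> right_units R"
    "x j * mon ?\<eta> - v * mon (\<lambda>i. ?\<alpha> i + \<beta> i) \<in> degree_less (Suc ?d)"
    using x_mult_mon[OF \<eta>(1) j] unfolding \<eta>' \<eta>(2) by blast
  have R: "u \<in> R" "v \<in> R" "?s \<in> R"
    using u v endo_power_closed upd(1) assms(3) unfolding right_units_def by auto
  have "x j * ((?s * u) * mon ?\<eta>) = (\<sigma> j ?s * \<sigma> j u * x j + \<delta> j (?s * u)) * mon ?\<eta>"
    using sigma(5)[OF j closed(4)[OF R(3,1)]] sigma(3)[OF j R(3,1)]
    by (simp add: mult.assoc[symmetric])
  then have xj: "x j * (?s * u * mon ?\<eta>) = \<sigma> j ?s * \<sigma> j u * (x j * mon ?\<eta>) + \<delta> j (?s * u) * mon ?\<eta>"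
    by (simp add: distrib_right mult.assoc)
  have "mon ?\<alpha> * (b * mon \<beta>) - endo_power n \<sigma> ?\<alpha> b * (\<sigma> j u * v) * mon (\<lambda>i. ?\<alpha> i + \<beta> i) =
    x j * (mon \<alpha> * (b * mon \<beta>) - ?s * u * mon ?\<eta>) + x j * (?s * u * mon ?\<eta>)
      - \<sigma> j ?s * \<sigma> j u * (v * mon (\<lambda>i. ?\<alpha> i + \<beta> i))"
    unfolding monomial_upd[OF j upd(3), symmetric] endo_power_upd[OF j upd(3)]
    by (simp add: right_diff_distrib mult.assoc)
  \<comment> \<open>The errors come from the induction hypothesis, from sorting \<open>x j\<close>
    into \<open>mon ?\<eta>\<close>, and from the derivation.\<close>
  also have "\<dots> = x j * (mon \<alpha> * (b * mon \<beta>) - ?s * u * mon ?\<eta>)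
      + \<sigma> j ?s * \<sigma> j u * (x j * mon ?\<eta> - v * mon (\<lambda>i. ?\<alpha> i + \<beta> i)) + \<delta> j (?s * u) * mon ?\<eta>"
    unfolding xj by (simp add: right_diff_distrib)
  also have "\<dots> \<in> degree_less (Suc ?d)"
  proof (intro lspan_add)
    show "x j * (mon \<alpha> * (b * mon \<beta>) - ?s * u * mon ?\<eta>) \<in> degree_less (Suc ?d)"
      by (rule x_mult_degree_less[OF j u(2)])
    show "\<sigma> j ?s * \<sigma> j u * (x j * mon ?\<eta> - v * mon (\<lambda>i. ?\<alpha> i + \<beta> i)) \<in> degree_less (Suc ?d)"
      by (rule lspan_scale[OF v(2) closed(4)[OF sigma(1)[OF j R(3)] sigma(1)[OF j R(1)]]])
    show "\<delta> j (?s * u) * mon ?\<eta> \<in> degree_less (Suc ?d)"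
      using \<eta> sigma(4)[OF j closed(4)[OF R(3,1)]] by (intro lspan_term) auto
  qed
  finally have "mon ?\<alpha> * (b * mon \<beta>) - endo_power n \<sigma> ?\<alpha> b * (\<sigma> j u * v) * mon (\<lambda>i. ?\<alpha> i + \<beta> i)
    \<in> degree_less (tdeg n ?\<alpha> + tdeg n \<beta>)"
    using tdeg_upd[OF j, of \<alpha>] by simp
  then show ?case using right_units_mult[OF right_units_sigma[OF j u(1)] v(1)] by blast
qed

text \<open>The top term lies below \<open>\<eta>\<close> by hypothesis, and the remainder has
  smaller degree than the top term, hence smaller rank.\<close>

lemma mon_mult_term_below:
  assumes E: "\<alpha> \<in> E" "\<beta> \<in> E" "\<eta> \<in> E" and b: "b \<in> R"
    and less: "rank n (\<lambda>i. \<alpha> i + \<beta> i) < rank n \<eta>"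
  shows "mon \<alpha> * (b * mon \<beta>) \<in> below \<eta>"
proof -
  let ?\<theta> = "\<lambda>i. \<alpha> i + \<beta> i"
  obtain u where u: "u \<in> right_units R"
    "mon \<alpha> * (b * mon \<beta>) - endo_power n \<sigma> \<alpha> b * u * mon ?\<theta> \<in> degree_less (tdeg n ?\<theta>)"
    using mon_mult_term[OF E(1,2) b] unfolding tdeg_add by blast
  from u(2) have "mon \<alpha> * (b * mon \<beta>) - endo_power n \<sigma> \<alpha> b * u * mon ?\<theta> \<in> below \<eta>"
    by (rule lspan_mono[OF degree_less_below]) (use less in auto)
  moreover have "endo_power n \<sigma> \<alpha> b * u * mon ?\<theta> \<in> below \<eta>"
    using u(1) endo_power_closed E b less exponents_add[OF E(1,2)]
    by (intro lspan_term closed) (auto simp: right_units_def)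
  ultimately show ?thesis using lspan_add by fastforce
qed

section \<open>Leading terms of arbitrary products\<close>

lemma has_lead_mult:
  assumes f: "has_lead f \<alpha> a" and g: "has_lead g \<beta> b"
  shows "\<exists>u\<in>right_units R. has_lead (f * g) (\<lambda>i. \<alpha> i + \<beta> i) (a * endo_power n \<sigma> \<alpha> b * u)"
proof -
  let ?\<eta> = "\<lambda>i. \<alpha> i + \<beta> i"
  let ?f = "f - a * mon \<alpha>" and ?g = "g - b * mon \<beta>"
  have E: "\<alpha> \<in> E" "\<beta> \<in> E" and R: "a \<in> R" "b \<in> R" and low: "?f \<in> below \<alpha>" "?g \<in> below \<beta>"
    using f g unfolding has_lead_def by auto
  have \<eta>: "?\<eta> \<in> E" using exponents_add E .
  obtain u where u: "u \<in> right_units R"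
    "mon \<alpha> * (b * mon \<beta>) - endo_power n \<sigma> \<alpha> b * u * mon ?\<eta> \<in> degree_less (tdeg n ?\<eta>)"
    using mon_mult_term[OF E R(2)] unfolding tdeg_add by blast
  have 1: "?f * ?g \<in> below ?\<eta>"
    using E by (intro lspan_mult[OF low] mon_mult_term_below \<eta> rank_add_less2) auto
  \<comment> \<open>A single term counts as a span over a singleton, so that
    \<open>lspan_mult\<close> also covers tail times leading term.\<close>
  have 2: "?f * (b * mon \<beta>) \<in> below ?\<eta>"
    by (rule lspan_mult[OF low(1) lspan_term[of \<beta> "{\<beta>}" b]])
      (use E R in \<open>auto intro!: mon_mult_term_below \<eta> rank_add_less\<close>)
  have "mon \<alpha> * ?g \<in> below ?\<eta>"
    by (rule lspan_mult[OF lspan_mon[of \<alpha> "{\<alpha>}"] low(2)])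
      (use E R rank_add_less[of _ n \<beta> \<alpha>] in \<open>auto intro!: mon_mult_term_below \<eta> simp: add.commute\<close>)
  then have 3: "a * (mon \<alpha> * ?g) \<in> below ?\<eta>" using R by (rule_tac lspan_scale)
  have 4: "a * (mon \<alpha> * (b * mon \<beta>) - endo_power n \<sigma> \<alpha> b * u * mon ?\<eta>) \<in> below ?\<eta>"
    using u(2) R by (intro lspan_scale degree_less_below)
  \<comment> \<open>Both factors are split into leading term and tail. Products involving a tail are
    small by monotonicity of the order, the last summand by degree.\<close>
  have "f * g - a * endo_power n \<sigma> \<alpha> b * u * mon ?\<eta> = ?f * ?g + ?f * (b * mon \<beta>)
    + a * (mon \<alpha> * ?g) + a * (mon \<alpha> * (b * mon \<beta>) - endo_power n \<sigma> \<alpha> b * u * mon ?\<eta>)"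
    by (simp add: algebra_simps)
  also have "\<dots> \<in> below ?\<eta>" by (intro lspan_add 1 2 3 4)
  finally have "f * g - a * endo_power n \<sigma> \<alpha> b * u * mon ?\<eta> \<in> below ?\<eta>" .
  moreover have "a * endo_power n \<sigma> \<alpha> b * u \<in> R"
    using u(1) R endo_power_closed[OF E(1)] by (intro closed) (auto simp: right_units_def)
  ultimately show ?thesis using u(1) \<eta> unfolding has_lead_def by blast
qed

lemma has_lead_mult_eq_0:
  assumes f: "has_lead f \<alpha> a" and g: "has_lead g \<beta> b" and "f * g = 0"
  shows "a * endo_power n \<sigma> \<alpha> b = 0"
  using has_lead_mult[OF f g] has_lead_0 right_units_cancel assms(3) by metis

text \<open>Ranks are injective, so at most one exponent has rank \<open>k\<close>; its coefficient
  is split off. There may be none, for instance if \<open>n = 0\<close> and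
  \<open>k > 0\<close>.\<close>

lemma lspan_rank_Suc:
  assumes "f \<in> lspan {\<gamma> \<in> E. rank n \<gamma> < Suc k}"
  obtains "f \<in> lspan {\<gamma> \<in> E. rank n \<gamma> < k}"
  | \<beta> b where "rank n \<beta> = k" "has_lead f \<beta> b"
proof (cases "\<exists>\<beta>\<in>E. rank n \<beta> = k")
  case True
  then obtain \<beta> where \<beta>: "\<beta> \<in> E" "rank n \<beta> = k" by blast
  have "{\<gamma> \<in> E. rank n \<gamma> < Suc k} \<subseteq> insert \<beta> {\<gamma> \<in> E. rank n \<gamma> < rank n \<beta>}"
  proof
    fix \<gamma> assume "\<gamma> \<in> {\<gamma> \<in> E. rank n \<gamma> < Suc k}"
    then show "\<gamma> \<in> insert \<beta> {\<gamma> \<in> E. rank n \<gamma> < rank n \<beta>}"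
      using inj_onD[OF rank_inj _ _ \<beta>(1), of \<gamma>] \<beta>(2) by (cases "rank n \<gamma> = k") simp_all
  qed
  from lspan_insert[OF assms this] show ?thesis
    using \<beta> that(2) unfolding has_lead_def by blast
next
  case False
  then have "{\<gamma> \<in> E. rank n \<gamma> < Suc k} = {\<gamma> \<in> E. rank n \<gamma> < k}" by (auto simp: less_Suc_eq)
  then show ?thesis using assms that(1) by simp
qed

lemma lspan_rank_ex: "\<exists>k. f \<in> lspan {\<gamma> \<in> E. rank n \<gamma> < k}"
  using lspan_UNIV[of f]
proof induction
  case zero
  show ?case by (blast intro: lspan.zero)
next
  case (add \<gamma> r s)
  then obtain k where "s \<in> lspan {\<gamma> \<in> E. rank n \<gamma> < k}" by blast
  then have "s \<in> lspan {\<epsilon> \<in> E. rank n \<epsilon> < max k (Suc (rank n \<gamma>))}" by (rule lspan_mono) auto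
  then show ?case using add by (intro exI lspan.add) auto
qed

section \<open>Annihilation of coefficients\<close>

text \<open>Induction on a rank bound: the top coefficient satisfies
  \<open>b * \<sigma>\<^sup>\<beta>(b) = 0\<close>, vanishes by rigidity, and the bound
  drops.\<close>

theorem extension_reduced:
  fixes f :: 'a
  assumes "f * f = 0"
  shows "f = 0"
proof -
  have "f \<in> lspan {\<gamma> \<in> E. rank n \<gamma> < k} \<Longrightarrow> f = 0" for k
  proof (induction k)
    case 0
    then show ?case by (auto elim: lspan.cases)
  next
    case (Suc k)
    from Suc.prems show ?case
    proof (cases rule: lspan_rank_Suc)
      case 1
      then show ?thesis by (rule Suc.IH)
    next
      case (2 \<beta> b)
      have "b * endo_power n \<sigma> \<beta> b = 0" using has_lead_mult_eq_0[OF 2(2) 2(2) assms] .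
      then have "b = 0" using rigidD 2(2) unfolding has_lead_def by blast
      then show ?thesis using 2 Suc.IH unfolding has_lead_def by simp
    qed
  qed
  then show ?thesis using lspan_rank_ex by blast
qed

lemmas insert_mult_zero = reduced_insert[OF extension_reduced]

text \<open>Induction on a rank bound for \<open>g\<close>. The hypothesis is applied to
  \<open>g * a\<close>, where the leading term of \<open>g\<close> has disappeared.\<close>

lemma lead_annihilates:
  assumes f: "has_lead f \<alpha> a" and "f * g = 0"
  shows "a * g = 0"
proof -
  have a: "a \<in> R" "\<alpha> \<in> E" using f unfolding has_lead_def by auto
  have "g \<in> lspan {\<gamma> \<in> E. rank n \<gamma> < k} \<Longrightarrow> f * g = 0 \<Longrightarrow> a * g = 0" for k g
  proof (induction k arbitrary: g)
    case 0
    then show ?case by (auto elim: lspan.cases)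
  next
    case (Suc k)
    from Suc.prems(1) show ?case
    proof (cases rule: lspan_rank_Suc)
      case 1
      then show ?thesis using Suc.IH Suc.prems(2) by blast
    next
      case (2 \<beta> b)
      let ?h = "g - b * mon \<beta>"
      have b: "b \<in> R" "\<beta> \<in> E" "?h \<in> lspan {\<gamma> \<in> E. rank n \<gamma> < k}"
        using 2 unfolding has_lead_def by auto
      have ab: "a * b = 0"
        using rigid_mult has_lead_mult_eq_0[OF f 2(2) Suc.prems(2)] a b by blast
      \<comment> \<open>Reducedness turns \<open>a * b = 0\<close> into the vanishing of
        \<open>b * r * a\<close> for every \<open>r\<close>.\<close>
      have "b * mon \<beta> * a = 0" by (rule insert_mult_zero(2)[OF _ ab])
      then have ha: "?h * a = g * a" by (simp add: left_diff_distrib)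
      have z: "(\<lambda>i. 0) \<in> E" by (simp add: exponents_def)
      \<comment> \<open>Right multiplication by a scalar, a term with zero exponent, creates no
        larger exponents, so the bound \<open>k\<close> persists.\<close>
      have "?h * a \<in> lspan {\<gamma> \<in> E. rank n \<gamma> < k}"
      proof (rule lspan_mult[OF b(3)])
        show "a \<in> lspan {\<lambda>i. 0}"
          using lspan_term[of "\<lambda>i. 0" "{\<lambda>i. 0}" a] a by (simp add: monomial_zero)
        show "mon \<gamma> * (d * mon \<epsilon>) \<in> lspan {\<gamma> \<in> E. rank n \<gamma> < k}"
          if "\<gamma> \<in> {\<gamma> \<in> E. rank n \<gamma> < k}" "d \<in> R" "\<epsilon> \<in> {\<lambda>i. 0}" for \<gamma> d \<epsilon>
          using mon_mult_term_below[of \<gamma> \<epsilon> \<beta> d] that b(2) z 2(1) by auto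
      qed
      moreover have "f * (?h * a) = 0"
        unfolding ha using Suc.prems(2) by (simp add: mult.assoc[symmetric])
      ultimately have "a * (g * a) = 0" using Suc.IH unfolding ha by blast
      \<comment> \<open>The factor \<open>a * (g * a)\<close> sits at the left of this
        square.\<close>
      then have "(a * g) * (a * g) = 0" by (simp add: mult.assoc[symmetric])
      then show ?thesis by (rule extension_reduced)
    qed
  qed
  then show ?thesis using lspan_rank_ex assms(2) by blast
qed

text \<open>Indices are added by increasing rank, so the new coefficient is a leading one and
  annihilates \<open>g\<close>; then its whole term annihilates \<open>g\<close> and can be
  removed.\<close>

lemma coefficients_annihilate:
  assumes "finite I" "inj_on \<alpha> I" "\<And>i. i \<in> I \<Longrightarrow> a i \<in> R \<and> \<alpha> i \<in> E"
    and "(\<Sum>i\<in>I. a i * mon (\<alpha> i)) * g = 0"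
  shows "\<forall>i\<in>I. a i * g = 0"
  using assms
proof (induction I rule: finite_ranking_induct[where f = "\<lambda>i. rank n (\<alpha> i)"])
  case empty
  show ?case by simp
next
  case (insert i I)
  show ?case
  proof (cases "i \<in> I")
    case True
    then show ?thesis using insert by (simp add: insert_absorb)
  next
    case False
    let ?s = "\<Sum>i\<in>I. a i * mon (\<alpha> i)"
    \<comment> \<open>The induction rule gives only a weak inequality; injectivity of
      \<open>\<alpha>\<close> and of the rank makes it strict.\<close>
    have less: "rank n (\<alpha> k) < rank n (\<alpha> i)" if "k \<in> I" for k
    proof -
      have "\<alpha> k \<noteq> \<alpha> i" using False that inj_onD[OF insert.prems(1), of k i] by auto
      then have "rank n (\<alpha> k) \<noteq> rank n (\<alpha> i)"
        using that insert.prems(2) inj_onD[OF rank_inj[of n]] by blast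
      then show ?thesis using insert.hyps(2)[OF that] by simp
    qed
    have sum: "(\<Sum>i\<in>insert i I. a i * mon (\<alpha> i)) = a i * mon (\<alpha> i) + ?s"
      using False insert.hyps(1) by simp
    have "?s \<in> below (\<alpha> i)"
      using insert.prems(2) less by (intro lspan_sum lspan_term) auto
    then have "has_lead (a i * mon (\<alpha> i) + ?s) (\<alpha> i) (a i)"
      using insert.prems(2) unfolding has_lead_def by simp
    from lead_annihilates[OF this] have i: "a i * g = 0" using insert.prems(3) unfolding sum by blast
    have "a i * mon (\<alpha> i) * g = 0" by (rule insert_mult_zero(1)[OF _ i])
    then have "?s * g = 0" using insert.prems(3) unfolding sum by (simp add: distrib_right)
    then show ?thesis using insert.IH insert.prems(1,2) i by simp
  qed
qed

theorem skew_Armendariz: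
  assumes f: "presentation R n x m a X" and g: "presentation R n x t b Y"
    and fg: "(\<Sum>i\<le>m. a i * X i) * (\<Sum>j\<le>t. b j * Y j) = 0"
    and i: "i \<le> m" and j: "j \<le> t"
  shows "a i * b j = 0"
proof -
  let ?g = "\<Sum>j\<le>t. b j * Y j"
  \<comment> \<open>Stated for arbitrary data because it is used twice: for \<open>f\<close> with
    right factor \<open>g\<close>, then for \<open>a i * g\<close> with right factor 1.\<close>
  have ann: "a i * h = 0"
    if P: "\<And>i. i \<le> m \<Longrightarrow> a i \<in> R \<and> X i \<in> Mon n x" "inj_on X {..m}"
      and "(\<Sum>i\<le>m. a i * X i) * h = 0" "i \<le> m" for m i :: nat and a X h
  proof -
    have "\<forall>i\<in>{..m}. \<exists>\<alpha>\<in>E. X i = mon \<alpha>" using P unfolding Mon_def by auto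
    then obtain \<alpha> where \<alpha>: "\<forall>i\<in>{..m}. \<alpha> i \<in> E \<and> X i = mon (\<alpha> i)" by metis
    have "inj_on \<alpha> {..m}"
      by (rule inj_onI) (metis P(2) \<alpha> inj_onD)
    moreover have "(\<Sum>i\<in>{..m}. a i * mon (\<alpha> i)) * h = 0"
      using that(3) \<alpha> by simp
    ultimately have "\<forall>i\<in>{..m}. a i * h = 0"
      using P(1) \<alpha> by (intro coefficients_annihilate) auto
    then show ?thesis using \<open>i \<le> m\<close> by simp
  qed
  have ai: "a i \<in> R" "a i * ?g = 0"
    using f ann[of m a X ?g i] fg i unfolding presentation_def by auto
  \<comment> \<open>This is \<open>a i * g = 0\<close>, read as a presentation with coefficients
    \<open>a i * b j\<close>; the factor 1 extracts each of them.\<close>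
  have "(\<Sum>j\<le>t. a i * b j * Y j) * 1 = 0"
    using ai(2) by (simp add: sum_distrib_left mult.assoc)
  then have "a i * b j * 1 = 0"
    by (rule ann[rotated 2]) (use g j ai closed in \<open>auto simp: presentation_def\<close>)
  then show ?thesis by simp
qed

end

theorem corollary3p11:
  fixes R :: "'a::ring_1 set" and n :: nat and x :: "nat \<Rightarrow> 'a"
    and \<sigma> \<delta> :: "nat \<Rightarrow> 'a \<Rightarrow> 'a"
  assumes "skew_PBW_extension R n x"
    and "associated_maps R n x \<sigma> \<delta>"
    and "Sigma_rigid R n \<sigma>"
  shows "skew_Pi_Armendariz R n x"
proof -
  interpret rigid_skew_PBW R n x \<sigma> \<delta>
    by unfold_locales (use assms in auto)
  have "0 \<in> nil R" unfolding nil_def using closed(1) by (auto intro!: exI[of _ 1])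
  \<comment> \<open>Reducedness makes the nilpotent product zero; all products of coefficients then
    vanish and are trivially nilpotent.\<close>
  moreover have "z = 0" if "z \<in> nil UNIV" for z :: 'a
    using that reduced_power_eq_0[OF extension_reduced] unfolding nil_def by blast
  ultimately show ?thesis
    unfolding skew_Pi_Armendariz_def using skew_Armendariz by metis
qed

end
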